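(* Consider the time-optimal problem on a 3-dimensional Lie group $G$ described in the context. If $\Omega$ is a strictly convex compact set containing the origin in its interior and $\partial\Omega^\circ$ is $C^k$-smooth for some $k\ge2$, then all extremals of the problem are bang and $C^k$-smooth. Moreover, there is no Cauchy nonuniqueness of extremals.
   Context: Let $G$ be a 3-dimensional Lie group with identity $\mathrm{Id}$ and let $X_1,X_2,X_3$ be left-invariant vector fields forming a basis of its Lie algebra with $[X_1,X_2]=X_3$, $[X_3,X_1]=aX_2$, $[X_3,X_2]=bX_1$, where $a,b\in\{-1,0,1\}$, $a+b\ge0$, $(a,b)\neq(0,0)$. Problem: $\dot q=u_1X_1(q)+u_2X_2(q)$, $u=(u_1,u_2)\in\Omega$ measurable, $q(0)=\mathrm{Id}$, $q(T)=q_1$, $T\to\min$. $\Omega^\circ=\{(p,q):px+qy\le1\ \forall(x,y)\in\Omega\}$ is the polar set. Let $h_i(\lambda)=\langle\lambda,X_i(\pi(\lambda))\rangle$ on $T^*G$ and $s_\Omega(h_1,h_2)=\max_{w\in\Omega}(w_1h_1+w_2h_2)$. An extremal is a Lipschitz curve $\lambda_t\in T^*_{q(t)}G$, $\lambda_t\ne0$, with control $u(t)$, such that $u_1h_1+u_2h_2=s_\Omega(h_1,h_2)=:H$, $\dot h_1=-u_2h_3$, $\dot h_2=u_1h_3$, $\dot h_3=-au_1h_2-bu_2h_1$, $\dot q=u_1X_1+u_2X_2$, $H\equiv\mathrm{const}\ge0$. Let $\mathfrak{S}_2$ be the set of $(h_1,h_2)$ at which $s_\Omega$ is not $C^2$.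 An extremal arc on $[\alpha,\beta]$ is bang if $(h_1,h_2)(\lambda_t)\notin\mathfrak{S}_2$ for all $t\in(\alpha,\beta)$. Cauchy nonuniqueness of extremals means the existence of two different extremals $\lambda^1_t\not\equiv\lambda^2_t$ with $\lambda^1_{t_0}=\lambda^2_{t_0}$ for some $t_0$.
   Formalization: The bang claim is stated only for extremals with H > 0: those with H = 0 have h1 = h2 = 0, where s_Ω is not differentiable, so they are never bang. C^k-smoothness and uniqueness cover all extremals. G is modeled inside a Euclidean space with smooth fields X1, X2. *)

theory Defs
  imports "HOL-Analysis.Analysis"
begin

definition polar :: "(real \<times> real) set \<Rightarrow> (real \<times> real) set" where
  "polar \<Omega> = {(p, q). \<forall>(x, y)\<in>\<Omega>. p * x + q * y \<le> 1}"

definition strictly_convex :: "(real \<times> real) set \<Rightarrow> bool" where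
  "strictly_convex \<Omega> \<longleftrightarrow> convex \<Omega> \<and>
     (\<forall>x\<in>\<Omega>. \<forall>y\<in>\<Omega>. x \<noteq> y \<longrightarrow> open_segment x y \<subseteq> interior \<Omega>)"

definition supp :: "(real \<times> real) set \<Rightarrow> real \<Rightarrow> real \<Rightarrow> real" where
  "supp \<Omega> h1 h2 = (SUP w\<in>\<Omega>. fst w * h1 + snd w * h2)"

fun dd :: "'a::real_normed_vector list \<Rightarrow> ('a \<Rightarrow> 'b::real_normed_vector) \<Rightarrow> 'a \<Rightarrow> 'b" where
  "dd [] f = f"
| "dd (v # vs) f = (\<lambda>x. frechet_derivative (dd vs f) (at x) v)"

definition Ck_on :: "nat \<Rightarrow> ('a::real_normed_vector \<Rightarrow> 'b::real_normed_vector) \<Rightarrow> 'a set \<Rightarrow> bool" where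
  "Ck_on k f S \<longleftrightarrow>
     (\<forall>vs. length vs < k \<longrightarrow> (\<forall>x\<in>S. dd vs f differentiable (at x))) \<and>
     (\<forall>vs. length vs \<le> k \<longrightarrow> continuous_on S (dd vs f))"

definition smooth_on :: "('a::real_normed_vector \<Rightarrow> 'b::real_normed_vector) \<Rightarrow> 'a set \<Rightarrow> bool" where
  "smooth_on f S \<longleftrightarrow> (\<forall>k. Ck_on k f S)"

fun vderiv :: "nat \<Rightarrow> (real \<Rightarrow> 'a::real_normed_vector) \<Rightarrow> real set \<Rightarrow> real \<Rightarrow> 'a" where
  "vderiv 0 \<gamma> I = \<gamma>"
| "vderiv (Suc n) \<gamma> I = (\<lambda>t. vector_derivative (vderiv n \<gamma> I) (at t within I))"

definition curve_Ck :: "nat \<Rightarrow> (real \<Rightarrow> 'a::real_normed_vector) \<Rightarrow> real set \<Rightarrow> bool" where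
  "curve_Ck k \<gamma> I \<longleftrightarrow>
     (\<forall>j<k. \<forall>t\<in>I. (vderiv j \<gamma> I has_vector_derivative vderiv (Suc j) \<gamma> I t) (at t within I)) \<and>
     continuous_on I (vderiv k \<gamma> I)"

definition Ck_boundary :: "nat \<Rightarrow> (real \<times> real) set \<Rightarrow> bool" where
  "Ck_boundary k K \<longleftrightarrow>
     (\<forall>p\<in>frontier K. \<exists>U (\<phi> :: real \<times> real \<Rightarrow> real).
        open U \<and> p \<in> U \<and> Ck_on k \<phi> U \<and>
        (\<forall>x\<in>U. \<exists>v. frechet_derivative \<phi> (at x) v \<noteq> 0) \<and>
        frontier K \<inter> U = {x\<in>U. \<phi> x = 0})"

definition S2 :: "(real \<times> real) set \<Rightarrow> (real \<times> real) set" where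
  "S2 \<Omega> = {h. \<not> (\<exists>U. open U \<and> h \<in> U \<and> Ck_on 2 (\<lambda>(h1, h2). supp \<Omega> h1 h2) U)}"

text \<open>Extremals, written in the left-invariant trivialization
  T*G = G \<times> R^3, lambda \<mapsto> (q, h1, h2, h3). The group G is represented inside a
  Euclidean space 'g, with X1, X2 the (smooth) left-invariant fields.
  The extremal is defined on the interval [t0, t1].\<close>
definition extremal ::
  "real \<Rightarrow> real \<Rightarrow> (real \<times> real) set \<Rightarrow> ('g::euclidean_space \<Rightarrow> 'g) \<Rightarrow> ('g \<Rightarrow> 'g) \<Rightarrow>
   real \<Rightarrow> real \<Rightarrow> (real \<Rightarrow> 'g \<times> real \<times> real \<times> real) \<Rightarrow> (real \<Rightarrow> real \<times> real) \<Rightarrow> bool" where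
  "extremal a b \<Omega> X1 X2 t0 t1 lam u \<longleftrightarrow>
     (let q = (\<lambda>t. fst (lam t)); h1 = (\<lambda>t. fst (snd (lam t)));
          h2 = (\<lambda>t. fst (snd (snd (lam t)))); h3 = (\<lambda>t. snd (snd (snd (lam t)))) in
      t0 < t1 \<and>
      (\<exists>L. L-lipschitz_on {t0..t1} lam) \<and>
      u \<in> borel_measurable (lebesgue_on {t0..t1}) \<and>
      (\<forall>t\<in>{t0..t1}. u t \<in> \<Omega>) \<and>
      (\<forall>t\<in>{t0..t1}. (h1 t, h2 t, h3 t) \<noteq> (0, 0, 0)) \<and>
      (\<exists>H\<ge>0. \<forall>t\<in>{t0..t1}. supp \<Omega> (h1 t) (h2 t) = H) \<and>
      (AE t in lebesgue_on {t0..t1}.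
         fst (u t) * h1 t + snd (u t) * h2 t = supp \<Omega> (h1 t) (h2 t) \<and>
         (h1 has_real_derivative (- snd (u t) * h3 t)) (at t within {t0..t1}) \<and>
         (h2 has_real_derivative (fst (u t) * h3 t)) (at t within {t0..t1}) \<and>
         (h3 has_real_derivative (- a * fst (u t) * h2 t - b * snd (u t) * h1 t))
            (at t within {t0..t1}) \<and>
         (q has_vector_derivative (fst (u t) *\<^sub>R X1 (q t) + snd (u t) *\<^sub>R X2 (q t)))
            (at t within {t0..t1})))"

definition bang :: "(real \<times> real) set \<Rightarrow> (real \<Rightarrow> 'g \<times> real \<times> real \<times> real) \<Rightarrow> real \<Rightarrow> real \<Rightarrow> bool" where
  "bang \<Omega> lam \<alpha> \<beta> \<longleftrightarrow>
     (\<forall>t\<in>{\<alpha><..<\<beta>}. (fst (snd (lam t)), fst (snd (snd (lam t)))) \<notin> S2 \<Omega>)"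

end

theory Submission
  imports Defs
begin

text \<open>The support function \<open>\<sigma>\<close> is differentiable away from the origin, with gradient the unique
  maximizer \<open>w(h)\<close>, because \<open>\<Omega>\<close> is strictly convex. If \<open>\<phi>\<close> is a local defining function of the polar
  boundary, which is the level set \<open>\<sigma> = 1\<close>, then the gradient of \<open>\<phi>\<close> is there parallel to \<open>w\<close>, and
  \<open>w(p) \<bullet> p = 1\<close> fixes the factor: \<open>w(p) \<bullet> v = \<phi>'(p) v / \<phi>'(p) p\<close>. So the gradient of \<open>\<sigma>\<close> at \<open>h\<close> is a
  function of class k - 1 of \<open>h / \<sigma>(h)\<close>, and bootstrapping makes \<open>\<sigma>\<close> of class k off the origin.

  On a positive level the control is almost everywhere \<open>w(h1, h2)\<close>, so the extremal is an integral
  curve of a vector field of class k - 1 with k - 1 at least 1. This gives the smoothness and the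
  uniqueness. On the zero level the extremal is constant.\<close>

section \<open>Functions of class k\<close>

text \<open>\<open>dd\<close> unfolds at the outermost derivative. Inductions on the class need the
  innermost one, which belongs to the last entry of the list.\<close>

lemma dd_snoc: "dd (vs @ [v]) f = dd vs (\<lambda>x. frechet_derivative f (at x) v)"
  by (induction vs) auto

lemma Ck_on_0: "Ck_on 0 f S \<longleftrightarrow> continuous_on S f"
  by (simp add: Ck_on_def)

text \<open>Splitting a direction list at its last entry turns the definition into a recursion on
  the class, on which the inductions below run.\<close>

lemma Ck_on_Suc:
  "Ck_on (Suc n) f S \<longleftrightarrow>
     (\<forall>x\<in>S. f differentiable at x) \<and> (\<forall>v. Ck_on n (\<lambda>x. frechet_derivative f (at x) v) S)"
proof
  assume L: "Ck_on (Suc n) f S"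
  show "(\<forall>x\<in>S. f differentiable at x) \<and> (\<forall>v. Ck_on n (\<lambda>x. frechet_derivative f (at x) v) S)"
  proof (intro conjI allI)
    show "\<forall>x\<in>S. f differentiable at x"
      using L unfolding Ck_on_def by (metis dd.simps(1) length_0_conv zero_less_Suc)
    fix v
    show "Ck_on n (\<lambda>x. frechet_derivative f (at x) v) S"
      using L unfolding Ck_on_def dd_snoc[symmetric]
      by (metis Suc_le_mono Suc_mono length_append_singleton)
  qed
next
  assume R: "(\<forall>x\<in>S. f differentiable at x) \<and> (\<forall>v. Ck_on n (\<lambda>x. frechet_derivative f (at x) v) S)"
  have 1: "dd vs f differentiable at x" if "length vs < Suc n" "x \<in> S" for vs x
    using that R by (cases vs rule: rev_cases) (auto simp: dd_snoc Ck_on_def)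
  have 2: "continuous_on S (dd vs f)" if "length vs \<le> Suc n" for vs
  proof (cases vs rule: rev_cases)
    case Nil
    then show ?thesis
      using R by (simp add: continuous_at_imp_continuous_on differentiable_imp_continuous_within)
  next
    case (snoc ws w)
    then show ?thesis using R that by (auto simp: dd_snoc Ck_on_def)
  qed
  show "Ck_on (Suc n) f S" using 1 2 by (auto simp: Ck_on_def)
qed

text \<open>On an open set, functions that agree have the same derivatives, so agreement passes down
  the recursion.\<close>

lemma Ck_on_cong:
  assumes "open S" "Ck_on n f S" "\<And>x. x \<in> S \<Longrightarrow> f x = g x"
  shows "Ck_on n g S"
  using assms(2,3)
proof (induction n arbitrary: f g)
  case 0
  then show ?case by (metis Ck_on_0 continuous_on_cong)
next
  case (Suc n)
  have d: "(g has_derivative frechet_derivative f (at x)) (at x)" if "x \<in> S" for x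
    by (metis Ck_on_Suc Suc.prems assms(1) frechet_derivative_works
        has_derivative_transform_within_open that)
  have "Ck_on n (\<lambda>x. frechet_derivative g (at x) v) S" for v
  proof (rule Suc.IH)
    show "Ck_on n (\<lambda>x. frechet_derivative f (at x) v) S" using Suc.prems Ck_on_Suc by blast
    show "frechet_derivative f (at x) v = frechet_derivative g (at x) v" if "x \<in> S" for x
      using d[OF that] frechet_derivative_at by metis
  qed
  with d show ?case unfolding Ck_on_Suc differentiable_def by blast
qed

text \<open>The derivative may be given by any explicit formula \<open>f'\<close>: uniqueness of
  derivatives identifies it with \<open>frechet_derivative\<close>.\<close>

lemma Ck_on_SucI:
  assumes "open S" "\<And>x. x \<in> S \<Longrightarrow> (f has_derivative f' x) (at x)"
    and "\<And>v. Ck_on n (\<lambda>x. f' x v) S"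
  shows "Ck_on (Suc n) f S"
  unfolding Ck_on_Suc
proof (intro conjI allI)
  show "\<forall>x\<in>S. f differentiable at x" using assms(2) differentiable_def by blast
  show "Ck_on n (\<lambda>x. frechet_derivative f (at x) v) S" for v
    by (rule Ck_on_cong[OF assms(1) assms(3)[of v]]) (metis assms(2) frechet_derivative_at)
qed

lemma Ck_on_has_derivative:
  "Ck_on (Suc n) f S \<Longrightarrow> x \<in> S \<Longrightarrow> (f has_derivative frechet_derivative f (at x)) (at x)"
  using frechet_derivative_works by (auto simp: Ck_on_Suc)

lemma Ck_on_frechet_derivative:
  "Ck_on (Suc n) f S \<Longrightarrow> Ck_on n (\<lambda>x. frechet_derivative f (at x) v) S"
  by (simp add: Ck_on_Suc)

lemma Ck_on_le: "Ck_on n f S \<Longrightarrow> m \<le> n \<Longrightarrow> Ck_on m f S"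
  by (auto simp: Ck_on_def)

lemma Ck_on_subset: "Ck_on n f S \<Longrightarrow> T \<subseteq> S \<Longrightarrow> Ck_on n f T"
  by (auto simp: Ck_on_def intro: continuous_on_subset)

lemma Ck_on_imp_continuous_on: "Ck_on n f S \<Longrightarrow> continuous_on S f"
  using Ck_on_le[of n f S 0] by (simp add: Ck_on_0)

text \<open>Differentiability and continuity at a point only see a neighbourhood. This is what
  allows a different local defining function at each point of the polar boundary.\<close>

lemma Ck_on_local:
  assumes "\<And>x. x \<in> S \<Longrightarrow> \<exists>V. open V \<and> x \<in> V \<and> Ck_on n f V"
  shows "Ck_on n f S"
  unfolding Ck_on_def
proof (intro conjI allI impI ballI)
  show "dd vs f differentiable at x" if "length vs < n" "x \<in> S" for vs x
    using assms[OF that(2)] that(1) by (auto simp: Ck_on_def)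
  show "continuous_on S (dd vs f)" if "length vs \<le> n" for vs
    using assms that by (intro continuous_at_imp_continuous_on ballI)
      (meson Ck_on_def continuous_on_eq_continuous_at)
qed

section \<open>Closure under arithmetic, pairing and composition\<close>

lemma Ck_on_const: "open S \<Longrightarrow> Ck_on n (\<lambda>x. c) S"
proof (induction n arbitrary: c)
  case 0
  then show ?case by (simp add: Ck_on_0)
next
  case (Suc n)
  show ?case by (rule Ck_on_SucI[OF Suc.prems has_derivative_const Suc.IH[OF Suc.prems]])
qed

lemma Ck_on_bounded_linear: "open S \<Longrightarrow> bounded_linear f \<Longrightarrow> Ck_on n f S"
proof (cases n)
  case 0
  then show "bounded_linear f \<Longrightarrow> ?thesis" by (simp add: Ck_on_0 linear_continuous_on)
next
  case (Suc m)
  assume "open S" "bounded_linear f"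
  then show ?thesis unfolding Suc
    by (intro Ck_on_SucI[of S f "\<lambda>_. f"] bounded_linear_imp_has_derivative Ck_on_const)
qed

lemma Ck_on_add:
  assumes "open S" "Ck_on n f S" "Ck_on n g S"
  shows "Ck_on n (\<lambda>x. f x + g x) S"
  using assms(2,3)
proof (induction n arbitrary: f g)
  case 0
  then show ?case by (simp add: Ck_on_0 continuous_on_add)
next
  case (Suc n)
  show ?case
    by (rule Ck_on_SucI[OF assms(1)])
      (rule has_derivative_add, (rule Ck_on_has_derivative, rule Suc.prems, assumption)+,
        intro Suc.IH Ck_on_frechet_derivative Suc.prems)
qed

lemma Ck_on_sum:
  assumes "open S" "\<And>i. i \<in> I \<Longrightarrow> Ck_on n (f i) S"
  shows "Ck_on n (\<lambda>x. \<Sum>i\<in>I. f i x) S"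
  using assms(2) by (induction I rule: infinite_finite_induct) (auto intro: Ck_on_add Ck_on_const assms(1))

lemma Ck_on_Pair:
  assumes "open S" "Ck_on n f S" "Ck_on n g S"
  shows "Ck_on n (\<lambda>x. (f x, g x)) S"
  using assms(2,3)
proof (induction n arbitrary: f g)
  case 0
  then show ?case by (simp add: Ck_on_0 continuous_on_Pair)
next
  case (Suc n)
  show ?case
    by (rule Ck_on_SucI[OF assms(1)])
      (rule has_derivative_Pair, (rule Ck_on_has_derivative, rule Suc.prems, assumption)+,
        intro Suc.IH Ck_on_frechet_derivative Suc.prems)
qed

lemma Ck_on_scaleR:
  fixes f :: "'a::real_normed_vector \<Rightarrow> real"
  assumes "open S" "Ck_on n f S" "Ck_on n g S"
  shows "Ck_on n (\<lambda>x. f x *\<^sub>R g x) S"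
  using assms(2,3)
proof (induction n arbitrary: f g)
  case 0
  then show ?case by (simp add: Ck_on_0 continuous_on_scaleR)
next
  case (Suc n)
  note fg = Suc.prems
  show ?case
    \<comment> \<open>Each summand of the product rule keeps one factor undifferentiated; it enters
      in class n only, hence \<open>Ck_on_le\<close>.\<close>
    by (rule Ck_on_SucI[OF assms(1)])
      (rule has_derivative_scaleR, (rule Ck_on_has_derivative, rule fg, assumption)+,
       intro Ck_on_add Suc.IH assms(1) Ck_on_frechet_derivative fg Ck_on_le[OF fg(1)] Ck_on_le[OF fg(2)], simp_all)
qed

lemma Ck_on_mult:
  fixes f g :: "'a::real_normed_vector \<Rightarrow> real"
  assumes "open S" "Ck_on n f S" "Ck_on n g S"
  shows "Ck_on n (\<lambda>x. f x * g x) S"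
  using Ck_on_scaleR[OF assms] by simp

lemma Ck_on_inverse:
  fixes f :: "'a::real_normed_vector \<Rightarrow> real"
  assumes "open S" "Ck_on n f S" "\<And>x. x \<in> S \<Longrightarrow> f x \<noteq> 0"
  shows "Ck_on n (\<lambda>x. inverse (f x)) S"
  using assms(2)
proof (induction n)
  case 0
  then show ?case using assms(3) by (simp add: Ck_on_0 continuous_on_inverse)
next
  case (Suc n)
  have i: "Ck_on n (\<lambda>x. inverse (f x)) S"
    using Suc.IH Ck_on_le[OF Suc.prems] by simp
  show ?case
  proof (rule Ck_on_SucI[OF assms(1)])
    \<comment> \<open>The derivative is expressed through \<open>inverse (f x)\<close> itself, so
      the induction hypothesis covers it; the sign is a constant factor to fit the product
      rule.\<close>
    show "((\<lambda>x. inverse (f x)) has_derivative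
        (\<lambda>v. (-1) * (inverse (f x) * frechet_derivative f (at x) v * inverse (f x)))) (at x)"
      if "x \<in> S" for x
      using Deriv.has_derivative_inverse[OF assms(3)[OF that] Ck_on_has_derivative[OF Suc.prems that]]
      by simp
    show "Ck_on n (\<lambda>x. (-1) * (inverse (f x) * frechet_derivative f (at x) v * inverse (f x))) S" for v
      by (intro Ck_on_mult Ck_on_const assms(1) i Ck_on_frechet_derivative[OF Suc.prems])
  qed
qed

lemma Ck_on_inner_left:
  assumes "open S" "Ck_on n f S"
  shows "Ck_on n (\<lambda>x. f x \<bullet> c) S"
  using assms(2)
proof (induction n arbitrary: f)
  case 0
  then show ?case by (simp add: Ck_on_0 continuous_on_inner)
next
  case (Suc n)
  show ?case
    by (rule Ck_on_SucI[OF assms(1)])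
      (rule has_derivative_inner_left, rule Ck_on_has_derivative, rule Suc.prems, assumption,
        intro Suc.IH Ck_on_frechet_derivative Suc.prems)
qed

text \<open>\<open>Ck_on\<close> speaks of derivatives in fixed directions. This expansion reduces a
  direction that varies with the point to finitely many fixed ones.\<close>

lemma linear_basis_expansion:
  fixes f :: "'a::euclidean_space \<Rightarrow> 'b::real_vector"
  assumes "linear f"
  shows "f x = (\<Sum>i\<in>Basis. (x \<bullet> i) *\<^sub>R f i)"
  by (metis (no_types, lifting) assms euclidean_representation linear_scale linear_sum sum.cong)

lemma Ck_on_compose:
  fixes g :: "'a::real_normed_vector \<Rightarrow> 'b::euclidean_space"
  assumes "open S" "open T" "Ck_on n f T" "Ck_on n g S" "g ` S \<subseteq> T"
  shows "Ck_on n (\<lambda>x. f (g x)) S"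
  using assms(3,4)
proof (induction n arbitrary: f)
  case 0
  then show ?case using assms(5) by (simp add: Ck_on_0 continuous_on_compose2)
next
  case (Suc n)
  let ?f' = "\<lambda>y. frechet_derivative f (at y)" and ?g' = "\<lambda>x. frechet_derivative g (at x)"
  have df: "(f has_derivative ?f' (g x)) (at (g x))" if "x \<in> S" for x
    using that assms(5) Suc.prems(1) Ck_on_has_derivative by blast
  show ?case
  proof (rule Ck_on_SucI[OF assms(1)])
    fix x assume x: "x \<in> S"
    have "((\<lambda>x. f (g x)) has_derivative (\<lambda>v. ?f' (g x) (?g' x v))) (at x)"
      using has_derivative_compose[OF Ck_on_has_derivative[OF Suc.prems(2) x] df[OF x]] .
    \<comment> \<open>The direction \<open>?g' x v\<close> varies with \<open>x\<close>; after
      expansion the outer derivatives have fixed directions and fall under the induction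
      hypothesis.\<close>
    moreover have "(\<lambda>v. ?f' (g x) (?g' x v)) = (\<lambda>v. \<Sum>i\<in>Basis. (?g' x v \<bullet> i) *\<^sub>R ?f' (g x) i)"
      by (rule ext) (rule linear_basis_expansion[OF has_derivative_linear[OF df[OF x]]])
    ultimately show "((\<lambda>x. f (g x)) has_derivative
        (\<lambda>v. \<Sum>i\<in>Basis. (?g' x v \<bullet> i) *\<^sub>R ?f' (g x) i)) (at x)"
      by (rule has_derivative_eq_rhs)
  next
    fix v
    have "Ck_on n (\<lambda>x. ?g' x v \<bullet> i) S" for i
      by (intro Ck_on_inner_left Ck_on_frechet_derivative assms(1) Suc.prems)
    moreover have "Ck_on n (\<lambda>x. ?f' (g x) i) S" for i
      by (rule Suc.IH) (use Suc.prems Ck_on_frechet_derivative Ck_on_le[of "Suc n" g S n] in auto)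
    ultimately show "Ck_on n (\<lambda>x. \<Sum>i\<in>Basis. (?g' x v \<bullet> i) *\<^sub>R ?f' (g x) i) S"
      by (intro Ck_on_sum Ck_on_scaleR assms(1))
  qed
qed

section \<open>Integral curves\<close>

text \<open>A tagged division is taken fine both for the derivative estimate and for the integral of
  the indicator of \<open>N\<close>. Intervals tagged outside \<open>N\<close> contribute at most e
  times their length; those tagged in \<open>N\<close> have total length below e and are controlled
  by the Lipschitz constant.\<close>

lemma lipschitz_on_zero_derivative_imp_const:
  fixes f :: "real \<Rightarrow> 'a::real_normed_vector"
  assumes "a \<le> b" "L-lipschitz_on {a..b} f" "negligible N"
    and der: "\<And>x. x \<in> {a..b} - N \<Longrightarrow> (f has_vector_derivative 0) (at x within {a..b})"
  shows "f b = f a"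
proof -
  have L: "L \<ge> 0" using assms(2) lipschitz_on_nonneg by blast
  have "norm (f b - f a) \<le> e * ((b - a) + L)" if "e > 0" for e
  proof -
    have "\<exists>d>0. x \<in> {a..b} - N \<longrightarrow>
        (\<forall>y\<in>{a..b}. norm (y-x) < d \<longrightarrow> norm (f y - f x) \<le> e * norm (y-x))" for x
    proof (cases "x \<in> {a..b} - N")
      case True
      then show ?thesis
        using der[OF True, unfolded has_vector_derivative_def has_derivative_within_alt] \<open>e > 0\<close>
        by fastforce
    qed (auto intro: exI[of _ 1])
    then obtain d where d: "\<And>x. 0 < d x"
      "\<And>x y. \<lbrakk>x \<in> {a..b} - N; y \<in> {a..b}; norm (y-x) < d x\<rbrakk> \<Longrightarrow> norm (f y - f x) \<le> e * norm (y-x)"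
      by metis
    \<comment> \<open>The Riemann sums of this indicator are the total lengths of the intervals
      tagged in \<open>N\<close>; its integral 0 makes them small.\<close>
    have "((indicator N :: real \<Rightarrow> real) has_integral 0) (cbox a b)"
      using \<open>negligible N\<close> by (simp only: negligible_def)
    then obtain \<gamma> where \<gamma>: "gauge \<gamma>"
      "\<And>p. p tagged_division_of (cbox a b) \<Longrightarrow> \<gamma> fine p \<Longrightarrow>
        norm ((\<Sum>(x,k)\<in>p. measure lborel k *\<^sub>R indicator N x) - (0::real)) < e"
      by (rule has_integralD[OF _ \<open>e > 0\<close>]) (rule that)
    have "gauge (\<lambda>x. \<gamma> x \<inter> ball x (d x))"
      by (intro gauge_Int \<gamma>(1) gauge_ball_dependent) (use d in auto)
    then obtain p where ptag: "p tagged_division_of cbox a b"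
      and fin: "(\<lambda>x. \<gamma> x \<inter> ball x (d x)) fine p"
      using fine_division_exists by blast
    have fine1: "\<gamma> fine p" and fine2: "(\<lambda>x. ball x (d x)) fine p"
      using fin by (auto simp: fine_def)
    \<comment> \<open>Length and increment of \<open>f\<close> both telescope over the
      division.\<close>
    have ba: "b - a = (\<Sum>(x,K)\<in>p. Sup K - Inf K)" "f b - f a = (\<Sum>(x,K)\<in>p. f(Sup K) - f(Inf K))"
      using additive_tagged_division_1[where f= "\<lambda>x. x"] additive_tagged_division_1[where f= f]
            \<open>a \<le> b\<close> ptag by auto
    have "norm (f b - f a) \<le>
        (\<Sum>n\<in>p. case n of (x,K) \<Rightarrow> e * (Sup K - Inf K) + L * (measure lborel K *\<^sub>R indicator N x))"
      unfolding ba(2)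
    proof (rule sum_norm_le, safe)
      fix x K
      assume xK: "(x, K) \<in> p"
      then obtain u v where k: "K = cbox u v" and x: "x \<in> K" and kab: "K \<subseteq> cbox a b"
        using ptag by (metis tagged_division_ofD(2-4))
      have "u \<le> v" using x k by auto
      have uv: "u \<in> K" "v \<in> K" by (simp_all add: \<open>u \<le> v\<close> k)
      have ball: "\<forall>y\<in>K. norm (y - x) < d x"
        using fineD[OF fine2 xK] by (auto simp: dist_norm norm_minus_commute)
      have SI: "Sup K = v" "Inf K = u" "measure lborel K = v - u" using \<open>u \<le> v\<close> k by auto
      show "norm (f (Sup K) - f (Inf K)) \<le> e * (Sup K - Inf K) + L * (measure lborel K *\<^sub>R indicator N x)"
      proof (cases "x \<in> N")
        case True
        have "norm (f v - f u) \<le> L * (v - u)"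
          using lipschitz_onD[OF assms(2), of v u] subsetD[OF kab uv(1)] subsetD[OF kab uv(2)] \<open>u \<le> v\<close>
          by (simp add: dist_norm)
        moreover have "0 \<le> e * (v - u)" using \<open>e > 0\<close> \<open>u \<le> v\<close> by simp
        ultimately show ?thesis using True by (simp add: SI)
      next
        case False
        have xab: "x \<in> {a..b} - N" using False x kab by auto
        have "norm (f v - f x) \<le> e * norm (v - x)" "norm (f u - f x) \<le> e * norm (u - x)"
          using d(2)[OF xab] ball uv kab by auto
        \<comment> \<open>The tag lies between \<open>u\<close> and \<open>v\<close>, so the two
          one-sided estimates add up to the length of the interval.\<close>
        moreover have "norm (v - x) = v - x" "norm (u - x) = x - u" using x k by auto
        ultimately have "norm (f v - f x) + norm (f u - f x) \<le> e * (v - u)"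
          by (simp add: algebra_simps)
        then have "norm (f v - f u) \<le> e * (v - u)"
          using norm_triangle_ineq4[of "f v - f x" "f u - f x"] by simp
        then show ?thesis using False by (simp add: SI)
      qed
    qed
    also have "\<dots> = e * (b - a) + L * (\<Sum>(x,k)\<in>p. measure lborel k *\<^sub>R indicator N x)"
      unfolding ba(1) by (simp add: split_def sum.distrib sum_distrib_left)
    also have "\<dots> \<le> e * (b - a) + L * e"
      using \<gamma>(2)[OF ptag fine1] L by (intro add_left_mono mult_left_mono) auto
    finally show ?thesis by (simp add: algebra_simps)
  qed
  note bound = this
  have "norm (f b - f a) \<le> 0"
  proof (rule field_le_epsilon)
    fix e :: real assume "e > 0"
    have "(b - a) + L + 1 > 0" using L \<open>a \<le> b\<close> by simp
    have "norm (f b - f a) \<le> (e / ((b - a) + L + 1)) * ((b - a) + L)"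
      using \<open>e > 0\<close> \<open>(b - a) + L + 1 > 0\<close> by (intro bound divide_pos_pos)
    also have "\<dots> \<le> 0 + e" using \<open>e > 0\<close> \<open>(b - a) + L + 1 > 0\<close> by (simp add: field_simps)
    finally show "norm (f b - f a) \<le> 0 + e" .
  qed
  then show ?thesis by simp
qed

text \<open>Subtracting the integral of \<open>v\<close> leaves a Lipschitz curve with derivative 0
  off \<open>N\<close>, hence a constant. So an equation valid almost everywhere, with continuous
  right-hand side, holds everywhere.\<close>

lemma lipschitz_on_has_vector_derivative:
  fixes \<gamma> :: "real \<Rightarrow> 'a::banach"
  assumes "a \<le> b" "L-lipschitz_on {a..b} \<gamma>" "negligible N" "continuous_on {a..b} v"
    and der: "\<And>t. t \<in> {a..b} - N \<Longrightarrow> (\<gamma> has_vector_derivative v t) (at t within {a..b})"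
    and t: "t \<in> {a..b}"
  shows "(\<gamma> has_vector_derivative v t) (at t within {a..b})"
proof -
  define J where "J = (\<lambda>t. integral {a..t} v)"
  have J: "(J has_vector_derivative v t) (at t within {a..b})" if "t \<in> {a..b}" for t
    unfolding J_def by (rule integral_has_vector_derivative[OF assms(4) that])
  obtain B where B: "\<And>t. t \<in> {a..b} \<Longrightarrow> norm (v t) \<le> B" "B > 0"
    using compact_imp_bounded[OF compact_continuous_image[OF assms(4) compact_Icc]]
    unfolding bounded_pos by (metis imageI)
  \<comment> \<open>The derivative \<open>v\<close> of \<open>J\<close> is bounded on the compact
    interval, so the mean value inequality applies.\<close>
  have "B-lipschitz_on {a..b} J"
  proof (rule lipschitz_onI)
    fix x y assume "x \<in> {a..b}" "y \<in> {a..b}"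
    have "norm (J x - J y) \<le> B * norm (x - y)"
    proof (rule differentiable_bound[of "{a..b}"])
      show "(J has_derivative (\<lambda>h. h *\<^sub>R v t)) (at t within {a..b})" if "t \<in> {a..b}" for t
        using J[OF that] by (simp add: has_vector_derivative_def)
      show "onorm (\<lambda>h. h *\<^sub>R v t) \<le> B" if "t \<in> {a..b}" for t
        using B(1)[OF that] by (intro onorm_le) (simp add: mult.commute[of B] mult_left_mono)
    qed (use \<open>x \<in> _\<close> \<open>y \<in> _\<close> in auto)
    then show "dist (J x) (J y) \<le> B * dist x y" by (simp add: dist_norm)
  qed (use B in simp)
  then have lip: "(L + B)-lipschitz_on {a..b} (\<lambda>t. \<gamma> t - J t)"
    by (intro lipschitz_on_diff assms)
  have eq: "\<gamma> s - J s = \<gamma> a - J a" if s: "s \<in> {a..b}" for s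
  proof (rule lipschitz_on_zero_derivative_imp_const[OF _ _ \<open>negligible N\<close>])
    show "(L + B)-lipschitz_on {a..s} (\<lambda>t. \<gamma> t - J t)"
      using lipschitz_on_subset[OF lip] s by auto
    show "((\<lambda>t. \<gamma> t - J t) has_vector_derivative 0) (at t within {a..s})"
      if "t \<in> {a..s} - N" for t
      using has_vector_derivative_diff[OF der J] that s
      by (intro has_vector_derivative_within_subset[of _ _ _ "{a..b}" "{a..s}"]) fastforce+
  qed (use s in auto)
  have "((\<lambda>s. J s + (\<gamma> a - J a)) has_vector_derivative v t) (at t within {a..b})"
    using has_vector_derivative_add[OF J[OF t] has_vector_derivative_const] by simp
  then show ?thesis
    by (rule has_vector_derivative_transform[OF t, rotated])
      (metis eq diff_add_cancel add.commute)
qed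

section \<open>Regularity of integral curves\<close>

text \<open>Each derivative of the curve is a function G of its position, and the chain rule
  replaces G by DG F, with one class fewer. Starting from the identity in class n + 1, class 0 is
  left after n + 1 steps.\<close>

lemma curve_Ck_integral_curve:
  fixes F :: "'a::euclidean_space \<Rightarrow> 'a"
  assumes W: "open W" "Ck_on n F W" and "a < b" and in_W: "\<And>t. t \<in> {a..b} \<Longrightarrow> \<gamma> t \<in> W"
    and der: "\<And>t. t \<in> {a..b} \<Longrightarrow> (\<gamma> has_vector_derivative F (\<gamma> t)) (at t within {a..b})"
  shows "curve_Ck (Suc n) \<gamma> {a..b}"
proof -
  let ?I = "{a..b}"
  have step: "\<exists>G'. Ck_on m G' W \<and> (\<forall>t\<in>?I. (g has_vector_derivative G' (\<gamma> t)) (at t within ?I))"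
    if G: "Ck_on (Suc m) G W" and "m \<le> n" and g: "\<And>t. t \<in> ?I \<Longrightarrow> g t = G (\<gamma> t)"
    for m g and G :: "'a \<Rightarrow> 'a"
  proof (intro exI conjI ballI)
    \<comment> \<open>This is DG(x) applied to F(x), in coordinates. The bound
      \<open>m \<le> n\<close> enters because \<open>F\<close> is only of class n.\<close>
    let ?G' = "\<lambda>x. \<Sum>i\<in>Basis. (F x \<bullet> i) *\<^sub>R frechet_derivative G (at x) i"
    show "Ck_on m ?G' W"
      by (intro Ck_on_sum Ck_on_scaleR Ck_on_inner_left W(1) Ck_on_frechet_derivative[OF G]
          Ck_on_le[OF W(2) \<open>m \<le> n\<close>])
    fix t assume t: "t \<in> ?I"
    have dG: "(G has_derivative frechet_derivative G (at (\<gamma> t))) (at (\<gamma> t))"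
      using G in_W[OF t] Ck_on_has_derivative by blast
    have "(G \<circ> \<gamma> has_vector_derivative frechet_derivative G (at (\<gamma> t)) (F (\<gamma> t))) (at t within ?I)"
      using der[OF t] dG has_derivative_at_withinI vector_derivative_diff_chain_within by blast
    moreover have "frechet_derivative G (at (\<gamma> t)) (F (\<gamma> t)) = ?G' (\<gamma> t)"
      using dG has_derivative_linear linear_basis_expansion by blast
    ultimately show "(g has_vector_derivative ?G' (\<gamma> t)) (at t within ?I)"
      by (metis (no_types, lifting) comp_apply g has_vector_derivative_transform t)
  qed
  have vd: "vector_derivative g (at t within ?I) = d"
    if "t \<in> ?I" "(g has_vector_derivative d) (at t within ?I)" for g :: "real \<Rightarrow> 'a" and t d
    using vector_derivative_within_closed_interval[OF \<open>a < b\<close> that] .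
  have F: "\<exists>G. Ck_on (Suc n - j) G W \<and> (\<forall>t\<in>?I. vderiv j \<gamma> ?I t = G (\<gamma> t))" if "j \<le> Suc n" for j
    using that
  proof (induction j)
    case 0
    have "Ck_on (Suc n) (\<lambda>x. x) W" by (intro Ck_on_bounded_linear W(1) bounded_linear_ident)
    then show ?case by auto
  next
    case (Suc j)
    then obtain G where G: "Ck_on (Suc (n - j)) G W" "\<And>t. t \<in> ?I \<Longrightarrow> vderiv j \<gamma> ?I t = G (\<gamma> t)"
      by (auto simp: Suc_diff_le)
    then obtain G' where "Ck_on (n - j) G' W"
      "\<And>t. t \<in> ?I \<Longrightarrow> (vderiv j \<gamma> ?I has_vector_derivative G' (\<gamma> t)) (at t within ?I)"
      using step[OF G(1) diff_le_self] by blast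
    then show ?case by (auto intro!: exI[of _ G'] vd)
  qed
  show ?thesis unfolding curve_Ck_def
  proof (intro conjI allI impI ballI)
    fix j t assume "j < Suc n" and t: "t \<in> ?I"
    then obtain G where G: "Ck_on (Suc (n - j)) G W" "\<And>t. t \<in> ?I \<Longrightarrow> vderiv j \<gamma> ?I t = G (\<gamma> t)"
      using F[of j] by (auto simp: Suc_diff_le)
    then obtain d where "(vderiv j \<gamma> ?I has_vector_derivative d) (at t within ?I)"
      using step[OF G(1) diff_le_self] t by blast
    then show "(vderiv j \<gamma> ?I has_vector_derivative vderiv (Suc j) \<gamma> ?I t) (at t within ?I)"
      using vd[OF t] by simp
  next
    obtain G where G: "Ck_on 0 G W" "\<And>t. t \<in> ?I \<Longrightarrow> vderiv (Suc n) \<gamma> ?I t = G (\<gamma> t)"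
      using F[of "Suc n"] by auto
    have "continuous_on ?I \<gamma>"
      by (rule continuous_on_vector_derivative[OF der])
    then have "continuous_on ?I (\<lambda>t. G (\<gamma> t))"
      using G(1) in_W by (auto simp: Ck_on_0 intro: continuous_on_compose2)
    then show "continuous_on ?I (vderiv (Suc n) \<gamma> ?I)"
      by (rule continuous_on_eq) (simp only: G(2))
  qed
qed

section \<open>Uniqueness of integral curves\<close>

text \<open>On a compact ball the partial derivatives are bounded, and a ball is convex, so the mean
  value inequality applies.\<close>

lemma C1_locally_lipschitz:
  fixes F :: "'a::euclidean_space \<Rightarrow> 'b::real_normed_vector"
  assumes "open W" "Ck_on 1 F W" "x \<in> W"
  obtains r L where "r > 0" "L-lipschitz_on (cball x r) F"
proof -
  let ?F' = "\<lambda>y. frechet_derivative F (at y)"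
  have C: "Ck_on (Suc 0) F W" using assms by simp
  obtain r where r: "r > 0" "cball x r \<subseteq> W"
    using assms open_contains_cball by blast
  have "\<exists>B. \<forall>y\<in>cball x r. norm (?F' y i) \<le> B" for i
  proof -
    have "continuous_on (cball x r) (\<lambda>y. ?F' y i)"
      using Ck_on_frechet_derivative[OF C, of i] r(2) continuous_on_subset by (auto simp: Ck_on_0)
    then have "bounded ((\<lambda>y. ?F' y i) ` cball x r)"
      using compact_cball compact_continuous_image compact_imp_bounded by blast
    then show ?thesis by (auto simp: bounded_iff)
  qed
  then obtain B where B: "\<And>i y. y \<in> cball x r \<Longrightarrow> norm (?F' y i) \<le> B i" by metis
  \<comment> \<open>Coordinates of v are bounded by its norm, so this sum bounds the operator norm
    of the derivative.\<close>
  let ?L = "\<Sum>i\<in>Basis. B i"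
  have B0: "0 \<le> B i" for i using B[of x i] r(1) norm_ge_zero[of "?F' x i"] by (simp del: norm_ge_zero)
  have "?L-lipschitz_on (cball x r) F"
  proof (rule lipschitz_onI)
    fix y z assume yz: "y \<in> cball x r" "z \<in> cball x r"
    have "norm (F y - F z) \<le> ?L * norm (y - z)"
    proof (rule differentiable_bound[of "cball x r" F ?F'])
      fix w assume w: "w \<in> cball x r"
      have dF: "(F has_derivative ?F' w) (at w)" using C r(2) w Ck_on_has_derivative by blast
      then show "(F has_derivative ?F' w) (at w within cball x r)" by (rule has_derivative_at_withinI)
      show "onorm (?F' w) \<le> ?L"
      proof (rule onorm_le)
        fix v
        have "norm (?F' w v) = norm (\<Sum>i\<in>Basis. (v \<bullet> i) *\<^sub>R ?F' w i)"
          using dF has_derivative_linear linear_basis_expansion by metis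
        also have "\<dots> \<le> (\<Sum>i\<in>Basis. B i * norm v)"
        proof (rule sum_norm_le)
          fix i :: 'a assume "i \<in> Basis"
          then have "\<bar>v \<bullet> i\<bar> \<le> norm v" by (rule Basis_le_norm)
          then show "norm ((v \<bullet> i) *\<^sub>R ?F' w i) \<le> B i * norm v"
            using B[OF w, of i] B0[of i] by (simp add: mult.commute[of "B i"] mult_mono)
        qed
        finally show "norm (?F' w v) \<le> ?L * norm v" by (simp add: sum_distrib_right)
      qed
    qed (use yz in auto)
    then show "dist (F y) (F z) \<le> ?L * dist y z" by (simp add: dist_norm)
  qed (use B0 in \<open>simp add: sum_nonneg\<close>)
  with r(1) show ?thesis using that by blast
qed

text \<open>The coincidence set contains \<open>\<tau>\<close>, is closed and, by a contraction
  estimate around each of its points, open in the interval; connectedness makes it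
  everything.\<close>

lemma integral_curve_unique:
  fixes F :: "'a::euclidean_space \<Rightarrow> 'a"
  assumes W: "open W" "Ck_on 1 F W"
    and \<gamma>W: "\<And>t. t \<in> {a..b} \<Longrightarrow> \<gamma> t \<in> W"
    and d\<gamma>: "\<And>t. t \<in> {a..b} \<Longrightarrow> (\<gamma> has_vector_derivative F (\<gamma> t)) (at t within {a..b})"
    and d\<delta>: "\<And>t. t \<in> {a..b} \<Longrightarrow> (\<delta> has_vector_derivative F (\<delta> t)) (at t within {a..b})"
    and \<tau>: "\<tau> \<in> {a..b}" "\<gamma> \<tau> = \<delta> \<tau>" and t: "t \<in> {a..b}"
  shows "\<gamma> t = \<delta> t"
proof -
  let ?I = "{a..b}"
  define E where "E = {t\<in>?I. \<gamma> t - \<delta> t = 0}"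
  have c: "continuous_on ?I \<gamma>" "continuous_on ?I \<delta>"
    by (rule continuous_on_vector_derivative[OF d\<gamma>] continuous_on_vector_derivative[OF d\<delta>]; assumption)+
  have cl: "closedin (top_of_set ?I) E"
    unfolding E_def by (intro continuous_closedin_preimage_constant continuous_on_diff c)
  have op: "openin (top_of_set ?I) E"
    unfolding openin_euclidean_subtopology_iff
  proof (intro conjI ballI)
    show "E \<subseteq> ?I" by (auto simp: E_def)
    fix s assume s: "s \<in> E"
    then have sI: "s \<in> ?I" and eq: "\<delta> s = \<gamma> s" by (auto simp: E_def)
    obtain r L where r: "r > 0" and L: "L-lipschitz_on (cball (\<gamma> s) r) F"
      using C1_locally_lipschitz[OF W \<gamma>W[OF sI]] by blast
    have L0: "L \<ge> 0" using L lipschitz_on_nonneg by blast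
    obtain d1 where d1: "d1 > 0" "\<And>y. y \<in> ?I \<Longrightarrow> dist y s < d1 \<Longrightarrow> dist (\<gamma> y) (\<gamma> s) < r"
      using c(1) sI r unfolding continuous_on_iff by metis
    obtain d2 where d2: "d2 > 0" "\<And>y. y \<in> ?I \<Longrightarrow> dist y s < d2 \<Longrightarrow> dist (\<delta> y) (\<gamma> s) < r"
      using c(2) sI r eq unfolding continuous_on_iff by metis
    \<comment> \<open>The halves keep the closed radius d strictly below \<open>d1\<close> and
      \<open>d2\<close>, so both curves stay in the ball where \<open>F\<close> is Lipschitz; the
      third entry gives \<open>L * d \<le> 1/2\<close>.\<close>
    define d where "d = min (min (d1/2) (d2/2)) (1 / (2 * (L + 1)))"
    have d: "d > 0" "d < d1" "d < d2" using d1(1) d2(1) L0 by (auto simp: d_def)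
    have "d \<le> 1 / (2 * (L + 1))" by (simp add: d_def)
    then have "L * d \<le> L * (1 / (2 * (L + 1)))" using L0 mult_left_mono by blast
    also have "\<dots> \<le> 1/2" using L0 by (simp add: field_simps)
    finally have Ld: "L * d \<le> 1/2" .
    define J where "J = {max a (s-d)..min b (s+d)}"
    have JI: "J \<subseteq> ?I" and sJ: "s \<in> J" using sI d by (auto simp: J_def)
    have Jd: "\<bar>y - s\<bar> \<le> d" if "y \<in> J" for y using that by (auto simp: J_def)
    have near: "\<gamma> y \<in> cball (\<gamma> s) r" "\<delta> y \<in> cball (\<gamma> s) r" if "y \<in> J" for y
      using d1(2)[of y] d2(2)[of y] Jd[OF that] d JI that
      by (auto simp: dist_real_def dist_commute less_imp_le)
    have "continuous_on J (\<lambda>y. norm (\<gamma> y - \<delta> y))"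
      using JI by (intro continuous_on_norm continuous_on_diff) (auto intro: continuous_on_subset c)
    then obtain z where z: "z \<in> J" "\<And>y. y \<in> J \<Longrightarrow> norm (\<gamma> y - \<delta> y) \<le> norm (\<gamma> z - \<delta> z)"
      using continuous_attains_sup[of J "\<lambda>y. norm (\<gamma> y - \<delta> y)"] sJ by (auto simp: J_def)
    let ?M = "norm (\<gamma> z - \<delta> z)"
    \<comment> \<open>The difference vanishes at \<open>s\<close>, so this bounds its maximum
      \<open>?M\<close> by \<open>L * ?M * d\<close>, at most half of itself; hence it is 0.\<close>
    have "norm ((\<gamma> z - \<delta> z) - (\<gamma> s - \<delta> s)) \<le> (L * ?M) * norm (z - s)"
    proof (rule differentiable_bound[of J "\<lambda>y. \<gamma> y - \<delta> y" "\<lambda>y h. h *\<^sub>R (F (\<gamma> y) - F (\<delta> y))"])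
      fix y assume y: "y \<in> J"
      show "((\<lambda>y. \<gamma> y - \<delta> y) has_derivative (\<lambda>h. h *\<^sub>R (F (\<gamma> y) - F (\<delta> y)))) (at y within J)"
        using has_vector_derivative_diff[OF d\<gamma>[of y] d\<delta>[of y]] y JI
        unfolding has_vector_derivative_def by (blast intro: has_derivative_subset)
      have "norm (F (\<gamma> y) - F (\<delta> y)) \<le> L * norm (\<gamma> y - \<delta> y)"
        using lipschitz_onD[OF L near[OF y]] by (simp add: dist_norm)
      also have "\<dots> \<le> L * ?M" using z(2)[OF y] L0 mult_left_mono by blast
      finally show "onorm (\<lambda>h. h *\<^sub>R (F (\<gamma> y) - F (\<delta> y))) \<le> L * ?M"
        by (intro onorm_le) (metis mult.commute mult_left_mono norm_ge_zero norm_scaleR real_norm_def)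
    qed (use z sJ in \<open>auto simp: J_def\<close>)
    also have "\<dots> \<le> (L * ?M) * d"
      using Jd[OF z(1)] L0 by (intro mult_left_mono) auto
    also have "\<dots> \<le> ?M / 2"
      using mult_right_mono[OF Ld, of ?M] by (simp add: mult.commute mult.left_commute)
    finally have "?M \<le> ?M / 2" using eq by simp
    then have M0: "?M = 0" using norm_ge_zero[of "\<gamma> z - \<delta> z"] by linarith
    show "\<exists>e>0. \<forall>x'\<in>?I. dist x' s < e \<longrightarrow> x' \<in> E"
    proof (intro exI conjI ballI impI)
      fix y assume y: "y \<in> ?I" "dist y s < d"
      then have "y \<in> J" by (auto simp: J_def dist_real_def)
      then show "y \<in> E" using z(2)[of y] M0 y by (auto simp: E_def)
    qed (use d in simp)
  qed
  have "E = {} \<or> E = ?I"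
    using connected_clopen[of ?I] op cl connected_Icc by blast
  moreover have "\<tau> \<in> E" using \<tau> by (simp add: E_def)
  ultimately have "t \<in> E" using t by blast
  then show ?thesis by (simp add: E_def)
qed

section \<open>The support function\<close>

locale strictly_convex_body =
  fixes \<Omega> :: "(real \<times> real) set"
  assumes compact: "compact \<Omega>" and strictly_convex: "strictly_convex \<Omega>"
    and zero_interior: "0 \<in> interior \<Omega>"
begin

section \<open>Maximizers of a linear form over the body\<close>

definition \<sigma> :: "real \<times> real \<Rightarrow> real" where "\<sigma> h = supp \<Omega> (fst h) (snd h)"

text \<open>Off the origin the choice is unambiguous (\<open>maximizer_unique\<close>). At the
  origin every point of \<open>\<Omega>\<close> qualifies and the value is arbitrary.\<close>

definition maximizer :: "real \<times> real \<Rightarrow> real \<times> real" where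
  "maximizer h = (SOME w. w \<in> \<Omega> \<and> w \<bullet> h = \<sigma> h)"

lemma \<sigma>_eq: "\<sigma> h = (SUP w\<in>\<Omega>. w \<bullet> h)"
  by (simp add: \<sigma>_def supp_def inner_prod_def)

lemma ex_maximizer: "\<exists>w\<in>\<Omega>. w \<bullet> h = \<sigma> h \<and> (\<forall>v\<in>\<Omega>. v \<bullet> h \<le> \<sigma> h)"
proof -
  have "\<Omega> \<noteq> {}" using zero_interior interior_subset by blast
  moreover have "continuous_on \<Omega> (\<lambda>w. w \<bullet> h)" by (intro continuous_intros)
  ultimately obtain w where w: "w \<in> \<Omega>" "\<And>v. v \<in> \<Omega> \<Longrightarrow> v \<bullet> h \<le> w \<bullet> h"
    using continuous_attains_sup[OF compact] by blast
  then have "\<sigma> h = w \<bullet> h"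
    unfolding \<sigma>_eq by (intro cSup_eq_maximum) auto
  with w show ?thesis by metis
qed

lemma inner_le_\<sigma>: "v \<in> \<Omega> \<Longrightarrow> v \<bullet> h \<le> \<sigma> h"
  using ex_maximizer by blast

lemma maximizer: "maximizer h \<in> \<Omega>" "maximizer h \<bullet> h = \<sigma> h"
  using someI_ex[of "\<lambda>w. w \<in> \<Omega> \<and> w \<bullet> h = \<sigma> h"] ex_maximizer
  unfolding maximizer_def by blast+

lemma \<sigma>_0 [simp]: "\<sigma> 0 = 0"
  using maximizer(2)[of 0] by simp

text \<open>An interior point can be moved a little in the direction \<open>h\<close> without
  leaving \<open>\<Omega>\<close>, which increases the inner product.\<close>

lemma interior_inner_less:
  assumes "v \<in> interior \<Omega>" "h \<noteq> 0"
  shows "v \<bullet> h < \<sigma> h"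
proof -
  obtain e where e: "e > 0" "ball v e \<subseteq> \<Omega>"
    using assms(1) mem_interior by blast
  have "v + (e / 2 / norm h) *\<^sub>R h \<in> ball v e"
    using e(1) assms(2) by (simp add: dist_norm)
  then have "(v + (e / 2 / norm h) *\<^sub>R h) \<bullet> h \<le> \<sigma> h"
    using e(2) inner_le_\<sigma> by blast
  moreover have "(e / 2 / norm h) * (h \<bullet> h) > 0"
    using e(1) assms(2) by simp
  ultimately show ?thesis by (simp add: inner_add_left)
qed

lemma \<sigma>_pos: "h \<noteq> 0 \<Longrightarrow> \<sigma> h > 0"
  using interior_inner_less[OF zero_interior] by simp

text \<open>The midpoint of two distinct maximizers would be a maximizer in the interior.\<close>

lemma maximizer_unique:
  assumes "h \<noteq> 0" "w \<in> \<Omega>" "w \<bullet> h = \<sigma> h"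
  shows "w = maximizer h"
proof (rule ccontr)
  assume "w \<noteq> maximizer h"
  then have "midpoint w (maximizer h) \<in> interior \<Omega>"
    using strictly_convex assms(2) maximizer(1) midpoint_in_open_segment
    unfolding strictly_convex_def by blast
  moreover have "midpoint w (maximizer h) \<bullet> h = \<sigma> h"
    using assms(3) maximizer(2)[of h] by (simp add: midpoint_def inner_add_left)
  ultimately show False using interior_inner_less[OF _ assms(1)] less_irrefl by metis
qed

lemma \<sigma>_scaleR:
  assumes "c > 0"
  shows "\<sigma> (c *\<^sub>R h) = c * \<sigma> h"
proof (rule antisym)
  show "\<sigma> (c *\<^sub>R h) \<le> c * \<sigma> h"
    using maximizer(2)[of "c *\<^sub>R h"] inner_le_\<sigma>[OF maximizer(1), of "c *\<^sub>R h" h] assms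
    by (metis inner_scaleR_right less_imp_le mult_left_mono)
  show "c * \<sigma> h \<le> \<sigma> (c *\<^sub>R h)"
    using maximizer(2)[of h] inner_le_\<sigma>[OF maximizer(1), of h "c *\<^sub>R h"] by simp
qed

lemma maximizer_scaleR:
  assumes "c > 0" "h \<noteq> 0"
  shows "maximizer (c *\<^sub>R h) = maximizer h"
  using maximizer_unique[of "c *\<^sub>R h" "maximizer h"] maximizer[of h] assms
  by (simp add: \<sigma>_scaleR)

section \<open>Continuity and gradient of the support function\<close>

text \<open>Subgradient inequality: the maximizer for \<open>h\<close> also competes for
  \<open>k\<close>. Used in both orders, it yields the Lipschitz bound and the derivative of
  \<open>\<sigma>\<close>.\<close>

lemma \<sigma>_diff_le: "\<sigma> h - \<sigma> k \<le> maximizer h \<bullet> (h - k)"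
  using maximizer(2)[of h] inner_le_\<sigma>[OF maximizer(1), of h k] by (simp add: inner_diff_right)

lemma continuous_on_\<sigma>: "continuous_on S \<sigma>"
proof -
  obtain R where R: "R > 0" "\<And>w. w \<in> \<Omega> \<Longrightarrow> norm w \<le> R"
    using compact_imp_bounded[OF compact] bounded_pos by blast
  have *: "\<sigma> h - \<sigma> k \<le> R * dist h k" for h k
  proof -
    have "\<sigma> h - \<sigma> k \<le> norm (maximizer h) * norm (h - k)"
      using \<sigma>_diff_le norm_cauchy_schwarz order_trans by blast
    also have "\<dots> \<le> R * norm (h - k)"
      using R(2)[OF maximizer(1)] by (intro mult_right_mono) auto
    finally show ?thesis by (simp add: dist_norm)
  qed
  have "R-lipschitz_on S \<sigma>"
    by (rule lipschitz_onI) (use * R(1) in \<open>simp_all add: dist_real_def abs_le_iff, metis dist_commute\<close>)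
  then show ?thesis by (rule lipschitz_on_continuous_on)
qed

text \<open>By uniqueness the graph is the solution set of a continuous equation, hence closed; a
  closed graph with values in a compact set gives continuity.\<close>

lemma continuous_on_maximizer: "continuous_on (- {0}) maximizer"
proof -
  let ?S = "- {0::real \<times> real}"
  have graph: "(\<lambda>x. (x, maximizer x)) ` ?S = {z \<in> ?S \<times> \<Omega>. snd z \<bullet> fst z - \<sigma> (fst z) = 0}"
    using maximizer maximizer_unique by (auto simp: image_iff)
  have "continuous_on (?S \<times> \<Omega>) (\<lambda>z. snd z \<bullet> fst z - \<sigma> (fst z))"
    by (intro continuous_intros continuous_on_compose2[OF continuous_on_\<sigma>[of UNIV]]) auto
  then have "closedin (top_of_set (?S \<times> \<Omega>)) ((\<lambda>x. (x, maximizer x)) ` ?S)"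
    unfolding graph by (rule continuous_closedin_preimage_constant)
  then show ?thesis
    using continuous_closed_graph_eq[OF compact, of maximizer ?S] maximizer(1) by auto
qed

text \<open>The two subgradient inequalities squeeze the remainder at y between 0 and
  \<open>(maximizer y - maximizer h) \<bullet> (y - h)\<close>, which is o(|y - h|) by continuity of
  the maximizer.\<close>

lemma \<sigma>_has_derivative:
  assumes "h \<noteq> 0"
  shows "(\<sigma> has_derivative (\<lambda>v. maximizer h \<bullet> v)) (at h)"
  unfolding has_derivative_at_alt
proof (intro conjI allI impI)
  show "bounded_linear (\<lambda>v. maximizer h \<bullet> v)" by (rule bounded_linear_inner_right)
  fix e :: real assume "e > 0"
  have "isCont maximizer h"
    using continuous_on_maximizer assms continuous_on_eq_continuous_at[of "- {0}"] by auto
  then obtain d where d: "d > 0" "\<And>y. dist y h < d \<Longrightarrow> dist (maximizer y) (maximizer h) < e"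
    using \<open>e > 0\<close> unfolding continuous_at_eps_delta by metis
  show "\<exists>d>0. \<forall>y. norm (y - h) < d \<longrightarrow>
      norm (\<sigma> y - \<sigma> h - maximizer h \<bullet> (y - h)) \<le> e * norm (y - h)"
  proof (intro exI conjI allI impI)
    fix y assume y: "norm (y - h) < d"
    have "\<sigma> y - \<sigma> h - maximizer h \<bullet> (y - h) \<ge> 0"
      using \<sigma>_diff_le[of h y] by (simp add: inner_diff_right)
    then have "norm (\<sigma> y - \<sigma> h - maximizer h \<bullet> (y - h)) \<le> (maximizer y - maximizer h) \<bullet> (y - h)"
      using \<sigma>_diff_le[of y h] by (simp add: inner_diff_left)
    also have "\<dots> \<le> norm (maximizer y - maximizer h) * norm (y - h)"
      by (rule norm_cauchy_schwarz)
    also have "\<dots> \<le> e * norm (y - h)"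
      using d(2)[of y] y by (intro mult_right_mono) (auto simp: dist_norm)
    finally show "norm (\<sigma> y - \<sigma> h - maximizer h \<bullet> (y - h)) \<le> e * norm (y - h)" .
  qed (rule d(1))
qed

section \<open>The polar boundary and its normal direction\<close>

lemma polar_eq: "polar \<Omega> = {h. \<sigma> h \<le> 1}"
proof -
  have "h \<in> polar \<Omega> \<longleftrightarrow> (\<forall>w\<in>\<Omega>. w \<bullet> h \<le> 1)" for h
    by (force simp: polar_def inner_prod_def mult.commute)
  also have "\<dots> h \<longleftrightarrow> \<sigma> h \<le> 1" for h
    using inner_le_\<sigma> ex_maximizer by (metis order_trans)
  finally show ?thesis by auto
qed

lemma frontier_polar: "frontier (polar \<Omega>) = {h. \<sigma> h = 1}"
proof -
  have "closed (polar \<Omega>)"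
    unfolding polar_eq by (intro closed_Collect_le continuous_on_\<sigma> continuous_on_const)
  moreover have "interior (polar \<Omega>) = {h. \<sigma> h < 1}"
  proof
    show "interior (polar \<Omega>) \<subseteq> {h. \<sigma> h < 1}"
    proof
      fix h assume h: "h \<in> interior (polar \<Omega>)"
      show "h \<in> {h. \<sigma> h < 1}"
      proof (rule ccontr)
        assume "h \<notin> {h. \<sigma> h < 1}"
        then have 1: "\<sigma> h \<ge> 1" by simp
        then have "h \<noteq> 0" by auto
        obtain e where e: "e > 0" "ball h e \<subseteq> polar \<Omega>" using h mem_interior by blast
        \<comment> \<open>Scaling by \<open>c\<close> moves \<open>h\<close> outward by e/2, within
          the ball, but multiplies \<open>\<sigma> h\<close> by more than 1 and so leaves the polar
          set.\<close>
        define c where "c = 1 + e / 2 / norm h"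
        have "c > 1" using e(1) \<open>h \<noteq> 0\<close> by (simp add: c_def)
        have "c *\<^sub>R h \<in> ball h e"
          using e(1) \<open>h \<noteq> 0\<close> by (simp add: c_def dist_norm scaleR_add_left)
        then have "c * \<sigma> h \<le> 1"
          using e(2) \<open>c > 1\<close> \<sigma>_scaleR[of c h] by (auto simp: polar_eq)
        moreover have "c * 1 \<le> c * \<sigma> h" using 1 \<open>c > 1\<close> by (intro mult_left_mono) auto
        ultimately show False using \<open>c > 1\<close> by linarith
      qed
    qed
    show "{h. \<sigma> h < 1} \<subseteq> interior (polar \<Omega>)"
      by (rule interior_maximal)
        (auto simp: polar_eq intro!: open_Collect_less continuous_on_\<sigma> continuous_on_const)
  qed
  ultimately show ?thesis by (auto simp: frontier_def polar_eq)
qed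

text \<open>The radial projection of the line p + sz, where z is tangent to the level curve, is a curve in
  the level set with velocity z at p.\<close>

lemma tangent_derivative_eq_0:
  assumes p: "\<sigma> p = 1" and z: "maximizer p \<bullet> z = 0"
    and U: "open U" "p \<in> U" "{h\<in>U. \<sigma> h = 1} \<subseteq> {h. \<phi> h = 0}"
    and d: "(\<phi> has_derivative \<phi>') (at p)"
  shows "\<phi>' z = 0"
proof -
  have "p \<noteq> 0" using p by auto
  define c where "c = (\<lambda>s::real. inverse (\<sigma> (p + s *\<^sub>R z)) *\<^sub>R (p + s *\<^sub>R z))"
  have c0: "c 0 = p" using p by (simp add: c_def)
  have dl: "((\<lambda>s::real. p + s *\<^sub>R z) has_derivative (\<lambda>s. s *\<^sub>R z)) (at 0)"
    by (auto intro!: derivative_eq_intros)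
  have d\<sigma>: "((\<lambda>s. \<sigma> (p + s *\<^sub>R z)) has_derivative (\<lambda>s. 0)) (at 0)"
    using has_derivative_compose[OF dl, of \<sigma> "\<lambda>v. maximizer p \<bullet> v"] \<sigma>_has_derivative[OF \<open>p \<noteq> 0\<close>] z
    by simp
  have dc: "(c has_derivative (\<lambda>s. s *\<^sub>R z)) (at 0)"
    unfolding c_def using p
    by (auto intro!: derivative_eq_intros d\<sigma> dl)
  then have "(\<phi> \<circ> c has_derivative \<phi>' \<circ> (\<lambda>s. s *\<^sub>R z)) (at 0)"
    using d c0 by (intro diff_chain_at) auto
  moreover have "(\<phi> \<circ> c has_derivative (\<lambda>_. 0)) (at 0)"
  proof (rule has_derivative_transform_eventually[OF has_derivative_const[of 0]])
    have "isCont c 0" using dc has_derivative_continuous by blast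
    then have 1: "\<forall>\<^sub>F s in at 0. c s \<in> U"
      using U(1,2) c0 by (simp add: continuous_at topological_tendstoD)
    have "isCont (\<lambda>s::real. p + s *\<^sub>R z) 0" by (intro continuous_intros)
    then have 2: "\<forall>\<^sub>F s in at 0. p + s *\<^sub>R z \<noteq> 0"
      using \<open>p \<noteq> 0\<close> by (intro tendsto_imp_eventually_ne[of _ p]) (simp_all add: continuous_at)
    have c1: "\<sigma> (c s) = 1" if "p + s *\<^sub>R z \<noteq> 0" for s
      using \<sigma>_pos[OF that] by (simp add: c_def \<sigma>_scaleR)
    show "\<forall>\<^sub>F s in at 0. 0 = (\<phi> \<circ> c) s"
      using 1 2 by eventually_elim (use c1 U(3) in auto)
    show "0 = (\<phi> \<circ> c) 0" using U c0 p by auto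
  qed auto
  ultimately have "(\<phi>' \<circ> (\<lambda>s. s *\<^sub>R z)) = (\<lambda>_. 0)" using has_derivative_unique by blast
  from fun_cong[OF this, of 1] show ?thesis by simp
qed

text \<open>Subtracting \<open>(maximizer p \<bullet> v) *\<^sub>R p\<close> from \<open>v\<close>
  leaves a tangent vector, because \<open>maximizer p \<bullet> p = 1\<close>; the derivative kills
  that vector.\<close>

lemma maximizer_inner_eq:
  assumes p: "\<sigma> p = 1"
    and U: "open U" "p \<in> U" "{h\<in>U. \<sigma> h = 1} \<subseteq> {h. \<phi> h = 0}"
    and d: "(\<phi> has_derivative \<phi>') (at p)"
  shows "\<phi>' v = (maximizer p \<bullet> v) * \<phi>' p"
proof -
  have lin: "linear \<phi>'" using d has_derivative_linear by blast
  have "\<phi>' (v - (maximizer p \<bullet> v) *\<^sub>R p) = 0"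
    using p maximizer(2)[of p]
    by (intro tangent_derivative_eq_0[OF p _ U d]) (simp add: inner_diff_right)
  then show ?thesis by (simp add: linear_diff[OF lin] linear_scale[OF lin])
qed

section \<open>From the class of the polar boundary to the class of the support function\<close>

lemma Ck_on_\<sigma>:
  assumes bd: "Ck_boundary k (polar \<Omega>)" and "k \<ge> 1"
  shows "Ck_on k \<sigma> (- {0})"
proof (rule Ck_on_local)
  fix h0 :: "real \<times> real" assume "h0 \<in> - {0}"
  then have h0: "h0 \<noteq> 0" by simp
  obtain m where k: "k = Suc m" using \<open>k \<ge> 1\<close> by (cases k) auto
  \<comment> \<open>Radial projection onto the polar boundary, where a defining function is
    available; the maximizer is constant along rays.\<close>
  define \<rho> where "\<rho> = (\<lambda>h. inverse (\<sigma> h) *\<^sub>R h)"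
  have \<rho>1: "\<sigma> (\<rho> h) = 1" if "h \<noteq> 0" for h
    using \<sigma>_pos[OF that] by (simp add: \<rho>_def \<sigma>_scaleR)
  have "\<rho> h0 \<in> frontier (polar \<Omega>)" using \<rho>1[OF h0] by (simp add: frontier_polar)
  with bd have "\<exists>U (\<phi> :: real \<times> real \<Rightarrow> real). open U \<and> \<rho> h0 \<in> U \<and> Ck_on k \<phi> U \<and>
      (\<forall>x\<in>U. \<exists>v. frechet_derivative \<phi> (at x) v \<noteq> 0) \<and> frontier (polar \<Omega>) \<inter> U = {x\<in>U. \<phi> x = 0}"
    unfolding Ck_boundary_def by (rule bspec)
  then obtain U and \<phi> :: "real \<times> real \<Rightarrow> real" where U: "open U" "\<rho> h0 \<in> U" "Ck_on k \<phi> U"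
    and nz: "\<forall>x\<in>U. \<exists>v. frechet_derivative \<phi> (at x) v \<noteq> 0"
    and fr: "frontier (polar \<Omega>) \<inter> U = {x\<in>U. \<phi> x = 0}"
    by (elim exE conjE) (rule that)
  let ?\<phi>' = "\<lambda>x. frechet_derivative \<phi> (at x)"
  have level: "{h\<in>U. \<sigma> h = 1} \<subseteq> {h. \<phi> h = 0}" using fr frontier_polar by auto
  have d\<phi>: "(\<phi> has_derivative ?\<phi>' x) (at x)" if "x \<in> U" for x
    using U(3) that Ck_on_has_derivative unfolding k by blast
  have eq: "?\<phi>' x v = (maximizer x \<bullet> v) * ?\<phi>' x x" if "x \<in> U" "\<sigma> x = 1" for x v
    using maximizer_inner_eq[OF that(2) U(1) that(1) level d\<phi>[OF that(1)]] .
  \<comment> \<open>The derivative of the defining function in the radial direction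
    \<open>x\<close>, in coordinates so that its class can be read off.\<close>
  define rad where "rad = (\<lambda>x. \<Sum>i\<in>Basis. (x \<bullet> i) *\<^sub>R ?\<phi>' x i)"
  have rad: "rad x = ?\<phi>' x x" if "x \<in> U" for x
    unfolding rad_def using linear_basis_expansion[OF has_derivative_linear[OF d\<phi>[OF that]]] by metis
  have C\<phi>': "Ck_on m (\<lambda>x. ?\<phi>' x v) U" for v
    using Ck_on_frechet_derivative U(3) unfolding k by blast
  have Crad: "Ck_on m rad U"
    unfolding rad_def
    by (intro Ck_on_sum Ck_on_scaleR Ck_on_inner_left Ck_on_bounded_linear bounded_linear_ident U(1) C\<phi>')
  define U' where "U' = U \<inter> rad -` (- {0})"
  have U': "open U'" "U' \<subseteq> U"
    unfolding U'_def using continuous_open_preimage[OF Ck_on_imp_continuous_on[OF Crad] U(1)] by auto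
  define A where "A = (\<lambda>v x. inverse (rad x) * ?\<phi>' x v)"
  have CA: "Ck_on m (A v) U'" for v
    unfolding A_def
    by (intro Ck_on_mult Ck_on_inverse U'(1) Ck_on_subset[OF Crad U'(2)] Ck_on_subset[OF C\<phi>' U'(2)])
      (simp add: U'_def)
  have c\<rho>: "continuous_on (- {0}) \<rho>"
    unfolding \<rho>_def using \<sigma>_pos by (intro continuous_intros continuous_on_\<sigma>) force
  define V where "V = (- {0}) \<inter> \<rho> -` U'"
  have V: "open V" unfolding V_def by (intro continuous_open_preimage c\<rho> U'(1)) auto
  have V0: "h \<noteq> 0" "\<rho> h \<in> U'" if "h \<in> V" for h using that by (auto simp: V_def)
  \<comment> \<open>If the radial derivative vanished here, \<open>eq\<close> would make the whole
    derivative vanish, against \<open>nz\<close>.\<close>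
  have "rad (\<rho> h0) \<noteq> 0" using bspec[OF nz U(2)] eq[OF U(2) \<rho>1[OF h0]] rad[OF U(2)] by (metis mult_zero_right)
  then have h0V: "h0 \<in> V" using h0 U(2) by (simp add: V_def U'_def)
  have max_eq: "maximizer h \<bullet> v = A v (\<rho> h)" if "h \<in> V" for h v
  proof -
    have h: "h \<noteq> 0" "\<rho> h \<in> U'" "\<rho> h \<in> U" using V0[OF that] U' by auto
    have "maximizer (\<rho> h) = maximizer h"
      unfolding \<rho>_def using h(1) \<sigma>_pos by (intro maximizer_scaleR) auto
    moreover have "rad (\<rho> h) \<noteq> 0" using h(2) by (simp add: U'_def)
    ultimately show ?thesis
      unfolding A_def using eq[OF h(3) \<rho>1[OF h(1)], of v] rad[OF h(3)] by (simp only: field_simps) simp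
  qed
  \<comment> \<open>The bootstrap: class j of \<open>\<sigma>\<close> passes to
    \<open>\<rho>\<close>, then to the gradient \<open>A v (\<rho> h)\<close> as long as j is at
    most m, and so gives class j + 1 of \<open>\<sigma>\<close>.\<close>
  have "j \<le> k \<Longrightarrow> Ck_on j \<sigma> V" for j
  proof (induction j)
    case 0
    then show ?case by (simp add: Ck_on_0 continuous_on_\<sigma>)
  next
    case (Suc j)
    then have C: "Ck_on j \<sigma> V" by simp
    have C\<rho>: "Ck_on j \<rho> V"
      unfolding \<rho>_def using V0(1) \<sigma>_pos
      by (intro Ck_on_scaleR Ck_on_inverse V C Ck_on_bounded_linear bounded_linear_ident) force
    show ?case
    proof (rule Ck_on_SucI[OF V])
      show "(\<sigma> has_derivative (\<lambda>v. maximizer h \<bullet> v)) (at h)" if "h \<in> V" for h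
        using \<sigma>_has_derivative V0(1)[OF that] .
      fix v
      have "Ck_on j (A v) U'" by (rule Ck_on_le[OF CA]) (use Suc.prems k in simp)
      then have "Ck_on j (\<lambda>h. A v (\<rho> h)) V"
        using V0(2) by (intro Ck_on_compose[OF V U'(1) _ C\<rho>]) auto
      then show "Ck_on j (\<lambda>h. maximizer h \<bullet> v) V"
        using V max_eq by (simp add: Ck_on_cong)
    qed
  qed
  then show "\<exists>V. open V \<and> h0 \<in> V \<and> Ck_on k \<sigma> V" using V h0V by blast
qed

text \<open>The components of the maximizer are the partial derivatives of
  \<open>\<sigma>\<close>.\<close>

lemma Ck_on_maximizer:
  assumes "Ck_boundary (Suc m) (polar \<Omega>)"
  shows "Ck_on m maximizer (- {0})"
proof -
  have C: "Ck_on (Suc m) \<sigma> (- {0})" using Ck_on_\<sigma>[OF assms] by simp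
  have "Ck_on m (\<lambda>h. (frechet_derivative \<sigma> (at h) (1, 0), frechet_derivative \<sigma> (at h) (0, 1))) (- {0})"
    by (intro Ck_on_Pair Ck_on_frechet_derivative[OF C]) auto
  moreover have "(frechet_derivative \<sigma> (at h) (1, 0), frechet_derivative \<sigma> (at h) (0, 1)) = maximizer h"
    if "h \<noteq> 0" for h
    using frechet_derivative_at[OF \<sigma>_has_derivative[OF that], symmetric]
    by (simp add: inner_prod_def)
  ultimately show ?thesis
    using Ck_on_cong[of "- {0}"] by (metis (no_types, lifting) ComplD insertI1 open_Compl closed_singleton)
qed

end

section \<open>Extremals\<close>

text \<open>The control enters as a feedback \<open>w\<close> of (h1, h2). A constant
  \<open>w\<close> freezes the control at one instant; \<open>w = maximizer\<close> gives the
  autonomous field of the positive level.\<close>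

definition extremal_field ::
  "real \<Rightarrow> real \<Rightarrow> ('g::euclidean_space \<Rightarrow> 'g) \<Rightarrow> ('g \<Rightarrow> 'g) \<Rightarrow> (real \<times> real \<Rightarrow> real \<times> real) \<Rightarrow>
   'g \<times> real \<times> real \<times> real \<Rightarrow> 'g \<times> real \<times> real \<times> real" where
  "extremal_field a b X1 X2 w = (\<lambda>(q, h1, h2, h3).
     (fst (w (h1, h2)) *\<^sub>R X1 q + snd (w (h1, h2)) *\<^sub>R X2 q,
      - snd (w (h1, h2)) * h3, fst (w (h1, h2)) * h3,
      - a * fst (w (h1, h2)) * h2 - b * snd (w (h1, h2)) * h1))"

abbreviation horizontal :: "'g \<times> real \<times> real \<times> real \<Rightarrow> real \<times> real" where
  "horizontal z \<equiv> (fst (snd z), fst (snd (snd z)))"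

lemma Ck_on_extremal_field:
  fixes X1 X2 :: "'g::euclidean_space \<Rightarrow> 'g"
  assumes S: "open S" and w: "Ck_on n w S" and X: "smooth_on X1 UNIV" "smooth_on X2 UNIV"
  shows "open {z :: 'g \<times> real \<times> real \<times> real. horizontal z \<in> S}"
    and "Ck_on n (extremal_field a b X1 X2 w) {z. horizontal z \<in> S}"
proof -
  let ?W = "{z :: 'g \<times> real \<times> real \<times> real. horizontal z \<in> S}"
  have "continuous_on UNIV (horizontal :: 'g \<times> real \<times> real \<times> real \<Rightarrow> _)"
    by (intro continuous_intros)
  then show W: "open ?W"
    using open_vimage[OF S] by (simp add: vimage_def)
  have bl: "bounded_linear (\<lambda>z :: 'g \<times> real \<times> real \<times> real. fst z)"
    "bounded_linear (\<lambda>z :: 'g \<times> real \<times> real \<times> real. fst (snd z))"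
    "bounded_linear (\<lambda>z :: 'g \<times> real \<times> real \<times> real. fst (snd (snd z)))"
    "bounded_linear (\<lambda>z :: 'g \<times> real \<times> real \<times> real. snd (snd (snd z)))"
    by (intro bounded_linear_compose[OF bounded_linear_fst] bounded_linear_compose[OF bounded_linear_snd]
        bounded_linear_fst bounded_linear_snd)+
  have C: "Ck_on n (\<lambda>z. fst z) ?W" "Ck_on n (\<lambda>z. fst (snd z)) ?W"
    "Ck_on n (\<lambda>z. fst (snd (snd z))) ?W" "Ck_on n (\<lambda>z. snd (snd (snd z))) ?W"
    by (intro Ck_on_bounded_linear W bl)+
  have wh: "Ck_on n (\<lambda>z. w (horizontal z)) ?W"
    by (intro Ck_on_compose[OF W S w] Ck_on_Pair W C) auto
  have "fst x = x \<bullet> (1, 0)" "snd x = x \<bullet> (0, 1)" for x :: "real \<times> real"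
    by (simp_all add: inner_prod_def)
  then have w1: "Ck_on n (\<lambda>z. fst (w (horizontal z))) ?W" and w2: "Ck_on n (\<lambda>z. snd (w (horizontal z))) ?W"
    using Ck_on_inner_left[OF W wh] by simp_all
  have XC: "Ck_on n (\<lambda>z. X1 (fst z)) ?W" "Ck_on n (\<lambda>z. X2 (fst z)) ?W"
    using X by (auto simp: smooth_on_def intro!: Ck_on_compose[OF W open_UNIV _ C(1)])
  \<comment> \<open>Projections replace patterns and signs become constant factors, so that the
    closure rules match.\<close>
  have "extremal_field a b X1 X2 w = (\<lambda>z.
     (fst (w (horizontal z)) *\<^sub>R X1 (fst z) + snd (w (horizontal z)) *\<^sub>R X2 (fst z),
      (- 1) * snd (w (horizontal z)) * snd (snd (snd z)), fst (w (horizontal z)) * snd (snd (snd z)),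
      (- a) * fst (w (horizontal z)) * fst (snd (snd z)) + (- b) * snd (w (horizontal z)) * fst (snd z)))"
    by (simp add: extremal_field_def split_def)
  then show "Ck_on n (extremal_field a b X1 X2 w) ?W"
    by (simp only:) (intro Ck_on_Pair Ck_on_add Ck_on_scaleR Ck_on_mult Ck_on_const W w1 w2 C XC)
qed

section \<open>Extremals on the positive and on the zero level\<close>

lemma (in strictly_convex_body) extremal_level:
  assumes "extremal a b \<Omega> X1 X2 t0 t1 lam u" "t \<in> {t0..t1}" "s \<in> {t0..t1}"
  shows "\<sigma> (horizontal (lam t)) = \<sigma> (horizontal (lam s))"
  using assms unfolding extremal_def Let_def \<sigma>_def by auto

text \<open>Collects the component equations into one equation for \<open>lam\<close> off a single
  negligible set, the form required by \<open>lipschitz_on_has_vector_derivative\<close>.\<close>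

lemma (in strictly_convex_body) extremal_ae:
  assumes "extremal a b \<Omega> X1 X2 t0 t1 lam u"
  obtains N where "negligible N" and "\<And>t. t \<in> {t0..t1} - N \<Longrightarrow> u t \<in> \<Omega> \<and>
      u t \<bullet> horizontal (lam t) = \<sigma> (horizontal (lam t)) \<and>
      (lam has_vector_derivative extremal_field a b X1 X2 (\<lambda>_. u t) (lam t)) (at t within {t0..t1})"
proof -
  let ?P = "\<lambda>t. fst (u t) * fst (snd (lam t)) + snd (u t) * fst (snd (snd (lam t)))
        = supp \<Omega> (fst (snd (lam t))) (fst (snd (snd (lam t)))) \<and>
      ((\<lambda>t. fst (snd (lam t))) has_real_derivative - snd (u t) * snd (snd (snd (lam t))))
        (at t within {t0..t1}) \<and>
      ((\<lambda>t. fst (snd (snd (lam t)))) has_real_derivative fst (u t) * snd (snd (snd (lam t))))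
        (at t within {t0..t1}) \<and>
      ((\<lambda>t. snd (snd (snd (lam t)))) has_real_derivative
        - a * fst (u t) * fst (snd (snd (lam t))) - b * snd (u t) * fst (snd (lam t)))
        (at t within {t0..t1}) \<and>
      ((\<lambda>t. fst (lam t)) has_vector_derivative
        fst (u t) *\<^sub>R X1 (fst (lam t)) + snd (u t) *\<^sub>R X2 (fst (lam t))) (at t within {t0..t1})"
  have "AE t in lebesgue_on {t0..t1}. ?P t" and u: "\<And>t. t \<in> {t0..t1} \<Longrightarrow> u t \<in> \<Omega>"
    using assms unfolding extremal_def Let_def by auto
  then obtain N where N: "N \<in> null_sets (lebesgue_on {t0..t1})" and P: "\<And>t. t \<in> {t0..t1} - N \<Longrightarrow> ?P t"
    using AE_E3 by (smt (verit) space_lebesgue_on)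
  show thesis
  proof
    show "negligible N"
      using N by (simp add: negligible_iff_null_sets null_sets_restrict_space)
    fix t assume t: "t \<in> {t0..t1} - N"
    have "(lam has_vector_derivative extremal_field a b X1 X2 (\<lambda>_. u t) (lam t)) (at t within {t0..t1})"
    proof -
      have "((\<lambda>t. (fst (lam t), fst (snd (lam t)), fst (snd (snd (lam t))), snd (snd (snd (lam t)))))
          has_vector_derivative extremal_field a b X1 X2 (\<lambda>_. u t) (lam t)) (at t within {t0..t1})"
        unfolding extremal_field_def split_def
        using P[OF t] by (intro has_vector_derivative_Pair)
          (simp_all add: has_real_derivative_iff_has_vector_derivative)
      then show ?thesis by simp
    qed
    with P[OF t] u t show "u t \<in> \<Omega> \<and> u t \<bullet> horizontal (lam t) = \<sigma> (horizontal (lam t)) \<and>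
      (lam has_vector_derivative extremal_field a b X1 X2 (\<lambda>_. u t) (lam t)) (at t within {t0..t1})"
      by (auto simp: inner_prod_def \<sigma>_def)
  qed
qed

text \<open>A positive level at \<open>\<tau>\<close> is positive throughout, so the maximum
  condition forces \<open>u = maximizer\<close> almost everywhere. The resulting field is continuous
  along \<open>lam\<close>, so the equation extends to every time.\<close>

lemma (in strictly_convex_body) extremal_regular:
  assumes ex: "extremal a b \<Omega> X1 X2 t0 t1 lam u"
    and bd: "Ck_boundary (Suc m) (polar \<Omega>)" and X: "smooth_on X1 UNIV" "smooth_on X2 UNIV"
    and \<tau>: "\<tau> \<in> {t0..t1}" "horizontal (lam \<tau>) \<noteq> 0" and t: "t \<in> {t0..t1}"
  shows "horizontal (lam t) \<noteq> 0"
    and "(lam has_vector_derivative extremal_field a b X1 X2 maximizer (lam t)) (at t within {t0..t1})"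
proof -
  have nz: "horizontal (lam t) \<noteq> 0" if "t \<in> {t0..t1}" for t
    using extremal_level[OF ex that \<tau>(1)] \<sigma>_pos[OF \<tau>(2)] by (metis \<sigma>_0 less_irrefl)
  then show "horizontal (lam t) \<noteq> 0" using t by blast
  obtain L where L: "L-lipschitz_on {t0..t1} lam" and "t0 < t1"
    using ex unfolding extremal_def Let_def by blast
  obtain N where N: "negligible N" and P: "\<And>t. t \<in> {t0..t1} - N \<Longrightarrow> u t \<in> \<Omega> \<and>
      u t \<bullet> horizontal (lam t) = \<sigma> (horizontal (lam t)) \<and>
      (lam has_vector_derivative extremal_field a b X1 X2 (\<lambda>_. u t) (lam t)) (at t within {t0..t1})"
    by (rule extremal_ae[OF ex]) (rule that)
  have "Ck_on m (extremal_field a b X1 X2 maximizer) {z. horizontal z \<in> - {0}}"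
    by (rule Ck_on_extremal_field(2)[OF _ Ck_on_maximizer[OF bd] X]) auto
  then have "continuous_on {t0..t1} (\<lambda>t. extremal_field a b X1 X2 maximizer (lam t))"
    using nz by (intro continuous_on_compose2[OF Ck_on_imp_continuous_on lipschitz_on_continuous_on[OF L]]) auto
  then show "(lam has_vector_derivative extremal_field a b X1 X2 maximizer (lam t)) (at t within {t0..t1})"
  proof (rule lipschitz_on_has_vector_derivative[OF less_imp_le[OF \<open>t0 < t1\<close>] L N _ _ t])
    fix s assume s: "s \<in> {t0..t1} - N"
    then have "u s = maximizer (horizontal (lam s))"
      using P[OF s] nz by (intro maximizer_unique) auto
    then have "extremal_field a b X1 X2 (\<lambda>_. u s) (lam s) = extremal_field a b X1 X2 maximizer (lam s)"
      by (simp add: extremal_field_def split_def)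
    then show "(lam has_vector_derivative extremal_field a b X1 X2 maximizer (lam s)) (at s within {t0..t1})"
      using P[OF s] by metis
  qed
qed

text \<open>On the zero level the horizontal part vanishes, so h3 does not, and the equations for h1 and h2
  force the control to vanish almost everywhere.\<close>

lemma (in strictly_convex_body) extremal_singular:
  assumes ex: "extremal a b \<Omega> X1 X2 t0 t1 lam u"
    and \<tau>: "\<tau> \<in> {t0..t1}" "horizontal (lam \<tau>) = 0" and t: "t \<in> {t0..t1}"
  shows "(lam has_vector_derivative 0) (at t within {t0..t1})"
proof -
  have z: "horizontal (lam t) = 0" if "t \<in> {t0..t1}" for t
    using extremal_level[OF ex that \<tau>(1)] \<sigma>_pos[of "horizontal (lam t)"] \<tau>(2) \<sigma>_0 by (metis less_irrefl)
  obtain L where L: "L-lipschitz_on {t0..t1} lam" and "t0 < t1"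
    using ex unfolding extremal_def Let_def by blast
  obtain N where N: "negligible N" and P: "\<And>t. t \<in> {t0..t1} - N \<Longrightarrow> u t \<in> \<Omega> \<and>
      u t \<bullet> horizontal (lam t) = \<sigma> (horizontal (lam t)) \<and>
      (lam has_vector_derivative extremal_field a b X1 X2 (\<lambda>_. u t) (lam t)) (at t within {t0..t1})"
    by (rule extremal_ae[OF ex]) (rule that)
  show ?thesis
  proof (rule lipschitz_on_has_vector_derivative[OF less_imp_le[OF \<open>t0 < t1\<close>] L N continuous_on_const _ t])
    fix s assume s: "s \<in> {t0..t1} - N"
    let ?F = "extremal_field a b X1 X2 (\<lambda>_. u s) (lam s)"
    have h: "fst (snd (lam s)) = 0" "fst (snd (snd (lam s))) = 0"
      using z[of s] s by (auto simp: zero_prod_def)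
    moreover have "(fst (snd (lam s)), fst (snd (snd (lam s))), snd (snd (snd (lam s)))) \<noteq> (0, 0, 0)"
      using ex s unfolding extremal_def Let_def by blast
    ultimately have h3: "snd (snd (snd (lam s))) \<noteq> 0" by auto
    have d: "(lam has_vector_derivative ?F) (at s within {t0..t1})" using P[OF s] by blast
    have sI: "s \<in> {t0..t1}" using s by simp
    have d1: "((\<lambda>t. horizontal (lam t)) has_vector_derivative horizontal ?F) (at s within {t0..t1})"
      using d unfolding has_vector_derivative_def
      by (auto intro!: derivative_eq_intros)
    \<comment> \<open>The horizontal part is identically 0 on the interval, so its derivative from
      \<open>d1\<close> must be 0 as well.\<close>
    have d2: "((\<lambda>t. horizontal (lam t)) has_vector_derivative 0) (at s within {t0..t1})"
      by (rule has_vector_derivative_transform[OF sI z has_vector_derivative_const])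
    have "horizontal ?F = 0"
      using vector_derivative_within_closed_interval[OF \<open>t0 < t1\<close> sI d1]
        vector_derivative_within_closed_interval[OF \<open>t0 < t1\<close> sI d2] by simp
    then have "fst (u s) = 0" "snd (u s) = 0"
      using h3 by (auto simp: extremal_field_def split_def zero_prod_def)
    then have "?F = 0" by (simp add: extremal_field_def split_def zero_prod_def)
    then show "(lam has_vector_derivative 0) (at s within {t0..t1})" using d by simp
  qed
qed

section \<open>Smoothness, bang arcs and uniqueness for all extremals\<close>

text \<open>The bang claim is stated for positive H, read off at \<open>t0\<close>: on the zero
  level (h1, h2) stays at the origin, where the support function has a corner. Uniqueness compares
  the curves and not the controls, since a control may be altered on a null set.\<close>

theorem theorem5:
  fixes a b :: real and \<Omega> :: "(real \<times> real) set" and k :: nat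
    and X1 X2 :: "'g::euclidean_space \<Rightarrow> 'g"
  assumes "a \<in> {-1, 0, 1}" and "b \<in> {-1, 0, 1}" and "a + b \<ge> 0" and "(a, b) \<noteq> (0, 0)"
    and "compact \<Omega>" and "strictly_convex \<Omega>" and "(0, 0) \<in> interior \<Omega>"
    and "k \<ge> 2" and "Ck_boundary k (polar \<Omega>)"
    and "smooth_on X1 UNIV" and "smooth_on X2 UNIV"
  shows "(\<forall>t0 t1 lam u. extremal a b \<Omega> X1 X2 t0 t1 lam u \<longrightarrow>
            (supp \<Omega> (fst (snd (lam t0))) (fst (snd (snd (lam t0)))) > 0 \<longrightarrow> bang \<Omega> lam t0 t1) \<and>
            curve_Ck k lam {t0..t1})
       \<and> (\<forall>t0 t1 lam u s0 s1 lam' u' \<tau>.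
            extremal a b \<Omega> X1 X2 t0 t1 lam u \<and> extremal a b \<Omega> X1 X2 s0 s1 lam' u' \<and>
            \<tau> \<in> {t0..t1} \<inter> {s0..s1} \<and> lam \<tau> = lam' \<tau> \<longrightarrow>
            (\<forall>t\<in>{t0..t1} \<inter> {s0..s1}. lam t = lam' t))"
proof -
  interpret strictly_convex_body \<Omega>
    by unfold_locales (use assms in \<open>simp_all add: zero_prod_def\<close>)
  \<comment> \<open>The field has class m, one below the polar boundary; \<open>m \<ge> 1\<close> is
    what uniqueness requires of it.\<close>
  obtain m where k: "k = Suc m" "m \<ge> 1" using \<open>k \<ge> 2\<close> by (cases k) auto
  have bd: "Ck_boundary (Suc m) (polar \<Omega>)" using assms k by simp
  note X = \<open>smooth_on X1 UNIV\<close> \<open>smooth_on X2 UNIV\<close>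
  define F where "F = extremal_field a b X1 X2 maximizer"
  define W where "W = {z :: 'g \<times> real \<times> real \<times> real. horizontal z \<in> - {0}}"
  have W: "open W" and F: "Ck_on m F W"
    unfolding F_def W_def using Ck_on_extremal_field[OF _ Ck_on_maximizer[OF bd] X] by auto
  have S2: "h \<notin> S2 \<Omega>" if "h \<noteq> 0" for h
  proof -
    have "Ck_on 2 \<sigma> (- {0})" using Ck_on_\<sigma>[OF \<open>Ck_boundary k _\<close>] Ck_on_le assms(8) by simp
    moreover have "(\<lambda>(h1, h2). supp \<Omega> h1 h2) = \<sigma>" by (auto simp: \<sigma>_def)
    ultimately show ?thesis using that unfolding S2_def by (auto intro!: exI[of _ "- {0}"])
  qed
  have regular: "\<forall>t\<in>{t0..t1}. lam t \<in> W \<and> (lam has_vector_derivative F (lam t)) (at t within {t0..t1})"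
    if "extremal a b \<Omega> X1 X2 t0 t1 lam u" "\<tau> \<in> {t0..t1}" "horizontal (lam \<tau>) \<noteq> 0" for t0 t1 lam u \<tau>
    unfolding W_def F_def using extremal_regular[OF that(1) bd X that(2,3)] by auto
  have smooth: "curve_Ck k lam {t0..t1}" if ex: "extremal a b \<Omega> X1 X2 t0 t1 lam u" for t0 t1 lam u
  proof -
    have "t0 < t1" using ex unfolding extremal_def Let_def by blast
    then have t0: "t0 \<in> {t0..t1}" by simp
    show ?thesis
    proof (cases "horizontal (lam t0) = 0")
      case True
      \<comment> \<open>On the zero level the extremal is an integral curve of the zero field on the
        whole space.\<close>
      show ?thesis unfolding k(1)
        by (rule curve_Ck_integral_curve[OF open_UNIV Ck_on_const[of UNIV m 0] \<open>t0 < t1\<close>])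
          (use extremal_singular[OF ex t0 True] in auto)
    next
      case False
      show ?thesis unfolding k(1)
        by (rule curve_Ck_integral_curve[OF W F \<open>t0 < t1\<close>]) (use regular[OF ex t0 False] in auto)
    qed
  qed
  have bangs: "bang \<Omega> lam t0 t1"
    if ex: "extremal a b \<Omega> X1 X2 t0 t1 lam u"
      and "supp \<Omega> (fst (snd (lam t0))) (fst (snd (snd (lam t0)))) > 0" for t0 t1 lam u
  proof -
    have "t0 \<in> {t0..t1}" using ex unfolding extremal_def Let_def by auto
    moreover have "horizontal (lam t0) \<noteq> 0" using that(2) \<sigma>_0 by (auto simp: \<sigma>_def zero_prod_def)
    ultimately have "\<forall>t\<in>{t0..t1}. lam t \<in> W" using regular[OF ex] by blast
    then show ?thesis unfolding bang_def using S2 by (auto simp: W_def)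
  qed
  have unique: "lam t = lam' t"
    if ex: "extremal a b \<Omega> X1 X2 t0 t1 lam u" "extremal a b \<Omega> X1 X2 s0 s1 lam' u'"
      and \<tau>: "\<tau> \<in> {t0..t1} \<inter> {s0..s1}" and eq: "lam \<tau> = lam' \<tau>" and t: "t \<in> {t0..t1} \<inter> {s0..s1}"
    for t0 t1 lam u s0 s1 lam' u' \<tau> t
  proof -
    \<comment> \<open>Both levels reduce to uniqueness for one common field on the overlap of the
      two time intervals.\<close>
    have field: ?thesis
      if V: "open V" "Ck_on 1 G V" "\<forall>t\<in>{t0..t1}. lam t \<in> V"
        and d: "\<forall>t\<in>{t0..t1}. (lam has_vector_derivative G (lam t)) (at t within {t0..t1})"
        and d': "\<forall>t\<in>{s0..s1}. (lam' has_vector_derivative G (lam' t)) (at t within {s0..s1})"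
      for V and G :: "'g \<times> real \<times> real \<times> real \<Rightarrow> 'g \<times> real \<times> real \<times> real"
    proof (rule integral_curve_unique[where \<tau> = \<tau> and a = "max t0 s0" and b = "min t1 s1", OF V(1,2)])
      fix r assume r: "r \<in> {max t0 s0..min t1 s1}"
      then show "lam r \<in> V" using V(3) by simp
      show "(lam has_vector_derivative G (lam r)) (at r within {max t0 s0..min t1 s1})"
        by (rule has_vector_derivative_within_subset[OF bspec[OF d]]) (use r in auto)
      show "(lam' has_vector_derivative G (lam' r)) (at r within {max t0 s0..min t1 s1})"
        by (rule has_vector_derivative_within_subset[OF bspec[OF d']]) (use r in auto)
    qed (use \<tau> eq t in auto)
    have \<tau>': "\<tau> \<in> {t0..t1}" "\<tau> \<in> {s0..s1}" using \<tau> by auto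
    show ?thesis
    proof (cases "horizontal (lam \<tau>) = 0")
      case True
      then have "horizontal (lam' \<tau>) = 0" using eq by simp
      then show ?thesis
        using extremal_singular[OF ex(1) \<tau>'(1) True] extremal_singular[OF ex(2) \<tau>'(2)]
        by (intro field[OF open_UNIV Ck_on_const[of UNIV 1 0]]) auto
    next
      case False
      then have "horizontal (lam' \<tau>) \<noteq> 0" using eq by simp
      then show ?thesis
        using regular[OF ex(1) \<tau>'(1) False] regular[OF ex(2) \<tau>'(2)] Ck_on_le[OF F k(2)] W
        by (intro field[of W F]) auto
    qed
  qed
  show ?thesis using smooth bangs unique by blast
qed

end
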